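(* Let $\alpha$ be a well-formed simple recursion of degree $d$ and let $b$ be a metering function for $\alpha$. Then for every integer substitution $\sigma$ with $\mathcal{V}(\alpha)\subseteq\mathrm{dom}(\sigma)$ there is an evaluation $\mathrm{lhs}(\alpha)\,\sigma\to_\alpha^m S$ of length $m$ for some configuration $S$ with $m\geq\frac{d^{b\sigma}-1}{d-1}$.
   Context: Fix a finite set $\Sigma$ of function symbols of common arity $k$, and variables ranging over $\mathbb{Z}$. Arithmetic expressions are built from variables, numbers and operations such as $+,-,\cdot$, division, exponentiation; a constraint is a finite conjunction of inequations between arithmetic expressions. A rule has the form $f(\vec x)\xrightarrow{c}T\ [\varphi]$ where $\vec x=(x_1,\dots,x_k)$ is a fixed vector of pairwise different program variables, $f\in\Sigma$, $c$ an arithmetic expression (cost), $T$ a finite multiset of terms $g(t_1,\dots,t_k)$ ($g\in\Sigma$, $t_i$ arithmetic expressions), $\varphi$ a constraint (guard); the degree of the rule is $|T|$. $\mathcal{V}(\cdot)$ is the set of variables occurring. Substitutions map variables to arithmetic expressions, applied homomorphically; $\{\vec x/\vec t\}$ maps each $x_i$ to $t_i$. An integer substitution maps variables in its domain to integers; $\sigma\models\varphi$ means $\mathcal{V}(\varphi)\subseteq\mathrm{dom}(\sigma)$ and $\sigma$ models $\varphi$. A formula is valid if every integer substitution whose domain contains its variables models it. A configuration is a finite multiset of terms $f(n_1,\dots,n_k)$, $n_i\in\mathbb{Z}$. $S\to_\alpha T$ if there are $s\in S$ and an integer substitution $\sigma$ with $\mathcal{V}(\alpha)\subseteq\mathrm{dom}(\sigma)$,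 $\mathrm{lhs}(\alpha)\sigma=s$, $\sigma\models\mathrm{guard}(\alpha)$ and $T=(S\setminus\{s\})\cup\mathrm{rhs}(\alpha)\sigma$ (multisets; equality modulo arithmetic); $\to_\alpha^m$ denotes $m$ such steps. A rule $\alpha$ is well formed if $t_i\sigma\in\mathbb{Z}$ for all $f(t_1,\dots,t_k)\in\mathrm{rhs}(\alpha)$, all $i$ and all integer $\sigma$ modelling the guard with all variables of $\alpha$ in its domain. A simple recursion is a rule $f(\vec x)\xrightarrow{c}T\ [\varphi]$ with $|T|>1$ in which every term of $T$ has root symbol $f$. An arithmetic expression $b$ is a metering function for a rule $\alpha = f(\vec x)\xrightarrow{c}T\ [\varphi]$ whose right-hand side contains no function symbol other than $f$ if $\neg\mathrm{guard}(\alpha)\implies b\leq 0$ is valid and $\mathrm{guard}(\alpha)\implies b\{\vec x/\vec t\}\geq b-1$ is valid for all $f(\vec t)\in T$. *)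

theory Defs
  imports Complex_Main "HOL-Library.Multiset"
begin

datatype (vars_exp: 'v) aexp =
    Var 'v
  | Num real
  | Plus "'v aexp" "'v aexp"
  | Minus "'v aexp" "'v aexp"
  | Times "'v aexp" "'v aexp"
  | Divide "'v aexp" "'v aexp"
  | Expo "'v aexp" "'v aexp"

text \<open>An integer substitution is a partial map into the integers, so that \<open>dom\<close> is its domain.\<close>

type_synonym 'v isubst = "'v \<rightharpoonup> int"

text \<open>
  Evaluation is partial: division by zero, negative powers of zero and non-integral powers of
  negative numbers have no value, rather than the default values of the library operations.
\<close>

definition div_partial :: "real \<Rightarrow> real \<Rightarrow> real option" where
  "div_partial u v = (if v = 0 then None else Some (u / v))"

definition expo_partial :: "real \<Rightarrow> real \<Rightarrow> real option" where
  "expo_partial u v =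
     (if u > 0 then Some (u powr v)
      else if v \<in> \<int> \<and> (u \<noteq> 0 \<or> v \<ge> 0) then Some (u powi \<lfloor>v\<rfloor>)
      else if u = 0 \<and> v > 0 then Some 0
      else None)"

definition lift2 :: "('a \<Rightarrow> 'b \<Rightarrow> 'c option) \<Rightarrow> 'a option \<Rightarrow> 'b option \<Rightarrow> 'c option" where
  "lift2 f x y = Option.bind x (\<lambda>u. Option.bind y (f u))"

primrec eval :: "'v isubst \<Rightarrow> 'v aexp \<Rightarrow> real option" where
  "eval \<sigma> (Var v) = map_option real_of_int (\<sigma> v)"
| "eval \<sigma> (Num r) = Some r"
| "eval \<sigma> (Plus a b) = lift2 (\<lambda>u v. Some (u + v)) (eval \<sigma> a) (eval \<sigma> b)"
| "eval \<sigma> (Minus a b) = lift2 (\<lambda>u v. Some (u - v)) (eval \<sigma> a) (eval \<sigma> b)"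
| "eval \<sigma> (Times a b) = lift2 (\<lambda>u v. Some (u * v)) (eval \<sigma> a) (eval \<sigma> b)"
| "eval \<sigma> (Divide a b) = lift2 div_partial (eval \<sigma> a) (eval \<sigma> b)"
| "eval \<sigma> (Expo a b) = lift2 expo_partial (eval \<sigma> a) (eval \<sigma> b)"

primrec subst_exp :: "('v \<rightharpoonup> 'v aexp) \<Rightarrow> 'v aexp \<Rightarrow> 'v aexp" where
  "subst_exp \<theta> (Var v) = (case \<theta> v of None \<Rightarrow> Var v | Some t \<Rightarrow> t)"
| "subst_exp \<theta> (Num r) = Num r"
| "subst_exp \<theta> (Plus a b) = Plus (subst_exp \<theta> a) (subst_exp \<theta> b)"
| "subst_exp \<theta> (Minus a b) = Minus (subst_exp \<theta> a) (subst_exp \<theta> b)"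
| "subst_exp \<theta> (Times a b) = Times (subst_exp \<theta> a) (subst_exp \<theta> b)"
| "subst_exp \<theta> (Divide a b) = Divide (subst_exp \<theta> a) (subst_exp \<theta> b)"
| "subst_exp \<theta> (Expo a b) = Expo (subst_exp \<theta> a) (subst_exp \<theta> b)"

datatype (vars_ineq: 'v) inequation =
    Less "'v aexp" "'v aexp"
  | Leq "'v aexp" "'v aexp"
  | Greater "'v aexp" "'v aexp"
  | Geq "'v aexp" "'v aexp"

text \<open>A constraint is the conjunction of the inequations in a list.\<close>

type_synonym 'v constraint = "'v inequation list"

datatype (vars_form: 'v) formula =
    Conj "'v constraint"
  | Neg "'v formula"
  | Imp "'v formula" "'v formula"

definition cmp :: "(real \<Rightarrow> real \<Rightarrow> bool) \<Rightarrow> real option \<Rightarrow> real option \<Rightarrow> bool" where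
  "cmp R x y \<longleftrightarrow> (\<exists>u v. x = Some u \<and> y = Some v \<and> R u v)"

primrec holds_ineq :: "'v isubst \<Rightarrow> 'v inequation \<Rightarrow> bool" where
  "holds_ineq \<sigma> (Less a b) \<longleftrightarrow> cmp (<) (eval \<sigma> a) (eval \<sigma> b)"
| "holds_ineq \<sigma> (Leq a b) \<longleftrightarrow> cmp (\<le>) (eval \<sigma> a) (eval \<sigma> b)"
| "holds_ineq \<sigma> (Greater a b) \<longleftrightarrow> cmp (>) (eval \<sigma> a) (eval \<sigma> b)"
| "holds_ineq \<sigma> (Geq a b) \<longleftrightarrow> cmp (\<ge>) (eval \<sigma> a) (eval \<sigma> b)"

primrec holds :: "'v isubst \<Rightarrow> 'v formula \<Rightarrow> bool" where
  "holds \<sigma> (Conj \<phi>) \<longleftrightarrow> (\<forall>i \<in> set \<phi>. holds_ineq \<sigma> i)"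
| "holds \<sigma> (Neg F) \<longleftrightarrow> \<not> holds \<sigma> F"
| "holds \<sigma> (Imp F G) \<longleftrightarrow> (holds \<sigma> F \<longrightarrow> holds \<sigma> G)"

definition models :: "'v isubst \<Rightarrow> 'v formula \<Rightarrow> bool" where
  "models \<sigma> F \<longleftrightarrow> vars_form F \<subseteq> dom \<sigma> \<and> holds \<sigma> F"

definition valid :: "'v formula \<Rightarrow> bool" where
  "valid F \<longleftrightarrow> (\<forall>\<sigma>. vars_form F \<subseteq> dom \<sigma> \<longrightarrow> models \<sigma> F)"

datatype ('f, vars_term: 'v) fterm = Fn (root: 'f) (args: "'v aexp list")

record ('f, 'v) prule =
  lhs :: "('f, 'v) fterm"
  cost :: "'v aexp"
  rhs :: "('f, 'v) fterm multiset"
  guard :: "'v constraint"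

definition vars_rule :: "('f, 'v) prule \<Rightarrow> 'v set" where
  "vars_rule \<alpha> = vars_term (lhs \<alpha>) \<union> vars_exp (cost \<alpha>)
     \<union> (\<Union>t \<in> set_mset (rhs \<alpha>). vars_term t) \<union> vars_form (Conj (guard \<alpha>))"

definition degree :: "('f, 'v) prule \<Rightarrow> nat" where
  "degree \<alpha> = size (rhs \<alpha>)"

text \<open>Rules over the signature \<open>\<Sigma>\<close> and the program variables \<open>xs\<close>; the common arity is the
  length of \<open>xs\<close>.\<close>

definition is_rule :: "'f set \<Rightarrow> 'v list \<Rightarrow> ('f, 'v) prule \<Rightarrow> bool" where
  "is_rule \<Sigma> xs \<alpha> \<longleftrightarrow>
     (\<exists>f \<in> \<Sigma>. lhs \<alpha> = Fn f (map Var xs)) \<and>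
     (\<forall>t \<in># rhs \<alpha>. root t \<in> \<Sigma> \<and> length (args t) = length xs)"

type_synonym 'f config = "('f \<times> int list) multiset"

definition configuration :: "'f set \<Rightarrow> nat \<Rightarrow> 'f config \<Rightarrow> bool" where
  "configuration \<Sigma> k S \<longleftrightarrow> (\<forall>(f, ns) \<in># S. f \<in> \<Sigma> \<and> length ns = k)"

text \<open>The instance of a term under \<open>\<sigma>\<close> equals, modulo arithmetic, the given term over integers.\<close>

definition instance_eq :: "'v isubst \<Rightarrow> ('f, 'v) fterm \<Rightarrow> 'f \<times> int list \<Rightarrow> bool" where
  "instance_eq \<sigma> t s \<longleftrightarrow> root t = fst s \<and>
     list_all2 (\<lambda>e n. eval \<sigma> e = Some (real_of_int n)) (args t) (snd s)"

definition step :: "('f, 'v) prule \<Rightarrow> 'f config \<Rightarrow> 'f config \<Rightarrow> bool" where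
  "step \<alpha> S T \<longleftrightarrow>
     (\<exists>s \<sigma> R. s \<in># S \<and> vars_rule \<alpha> \<subseteq> dom \<sigma> \<and> instance_eq \<sigma> (lhs \<alpha>) s \<and>
        models \<sigma> (Conj (guard \<alpha>)) \<and> rel_mset (instance_eq \<sigma>) (rhs \<alpha>) R \<and>
        T = (S - {#s#}) + R)"

definition well_formed :: "('f, 'v) prule \<Rightarrow> bool" where
  "well_formed \<alpha> \<longleftrightarrow>
     (\<forall>\<sigma>. vars_rule \<alpha> \<subseteq> dom \<sigma> \<and> models \<sigma> (Conj (guard \<alpha>)) \<longrightarrow>
        (\<forall>t \<in># rhs \<alpha>. \<forall>e \<in> set (args t). \<exists>n. eval \<sigma> e = Some (real_of_int n)))"

definition simple_recursion :: "('f, 'v) prule \<Rightarrow> bool" where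
  "simple_recursion \<alpha> \<longleftrightarrow> degree \<alpha> > 1 \<and> (\<forall>t \<in># rhs \<alpha>. root t = root (lhs \<alpha>))"

definition metering_function :: "'v list \<Rightarrow> 'v aexp \<Rightarrow> ('f, 'v) prule \<Rightarrow> bool" where
  "metering_function xs b \<alpha> \<longleftrightarrow>
     (\<forall>t \<in># rhs \<alpha>. root t = root (lhs \<alpha>)) \<and>
     valid (Imp (Neg (Conj (guard \<alpha>))) (Conj [Leq b (Num 0)])) \<and>
     (\<forall>t \<in># rhs \<alpha>.
        valid (Imp (Conj (guard \<alpha>))
          (Conj [Geq (subst_exp (map_of (zip xs (args t))) b) (Minus b (Num 1))])))"

end

theory Submission
  imports Defs
begin

text \<open>
  Keep the values of all non-program variables fixed along the evaluation, so that a recursive call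
  \<open>f(t)\<close> under \<open>\<sigma>\<close> corresponds to the substitution that updates the program variables to the values
  of \<open>t\<close>, and \<open>b{x/t}\<close> under \<open>\<sigma>\<close> is \<open>b\<close> under the updated substitution. Where \<open>b\<close> is positive the
  guard holds, and each of the \<open>d\<close> recursive calls decreases \<open>b\<close> by at most \<open>1\<close>. The bound
  \<open>p(v) = (d\<^sup>v - 1) / (d - 1)\<close> satisfies \<open>p(v) = 1 + d \<cdot> p(v - 1)\<close>, and the bound
  \<open>p(u)\<close> for every \<open>u\<close> below the value of \<open>b\<close> follows by induction on the ceiling of \<open>u\<close>. The extra
  parameter \<open>u\<close> is needed because \<open>b\<close> may also increase along a recursive call.
\<close>

lemma eval_subst_exp:
  assumes "\<And>v. eval \<sigma> (subst_exp \<theta> (Var v)) = eval \<tau> (Var v)"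
  shows "eval \<sigma> (subst_exp \<theta> e) = eval \<tau> e"
  using assms by (induction e) simp_all

lemma vars_subst_exp_subset:
  "vars_exp (subst_exp \<theta> e) \<subseteq> vars_exp e \<union> (\<Union>t \<in> ran \<theta>. vars_exp t)"
  by (induction e) (auto split: option.splits intro: ranI)

text \<open>Both look-ups with \<open>map_of\<close> pick the same position of \<open>xs\<close>,
  and variables outside \<open>xs\<close> keep their value under \<sigma>. The equation is between
  options, so undefined values agree as well.\<close>

lemma eval_subst_exp_zip:
  assumes "list_all2 (\<lambda>e n. eval \<sigma> e = Some (real_of_int n)) ts ns"
    and "length ts = length xs"
  shows "eval \<sigma> (subst_exp (map_of (zip xs ts)) e) = eval (\<sigma> ++ map_of (zip xs ns)) e"
proof (rule eval_subst_exp)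
  fix v
  show "eval \<sigma> (subst_exp (map_of (zip xs ts)) (Var v)) = eval (\<sigma> ++ map_of (zip xs ns)) (Var v)"
    using assms
  proof (induction xs arbitrary: ts ns)
    case (Cons x xs)
    then obtain t ts' where ts: "ts = t # ts'" by (cases ts) auto
    with Cons.prems obtain n ns' where ns: "ns = n # ns'" by (cases ns) auto
    from Cons show ?case by (auto simp: ts ns map_add_def)
  qed simp
qed

text \<open>Since \<open>xs\<close> is distinct, no entry of the update shadows another. This makes
  the left-hand side match a called term under the updated substitution.\<close>

lemma eval_map_Var_zip:
  assumes "distinct xs" and "length xs = length ns"
  shows "list_all2 (\<lambda>e n. eval (\<sigma> ++ map_of (zip xs ns)) e = Some (real_of_int n)) (map Var xs) ns"
  using assms by (auto simp: list_all2_conv_all_nth map_add_def map_of_zip_nth)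

lemma step_add:
  assumes "step \<alpha> S T"
  shows "step \<alpha> (S + U) (T + U)"
proof -
  obtain s \<sigma> R where s: "s \<in># S" and *: "vars_rule \<alpha> \<subseteq> dom \<sigma>" "instance_eq \<sigma> (lhs \<alpha>) s"
    "models \<sigma> (Conj (guard \<alpha>))" "rel_mset (instance_eq \<sigma>) (rhs \<alpha>) R" and T: "T = S - {#s#} + R"
    using assms unfolding step_def by blast
  have "s \<in># S + U" "T + U = S + U - {#s#} + R"
    using s by (auto simp: T ac_simps)
  then show ?thesis
    using * unfolding step_def by blast
qed

lemma relpowp_step_add:
  "(step \<alpha> ^^ m) S T \<Longrightarrow> (step \<alpha> ^^ m) (S + U) (T + U)"
  by (induction m arbitrary: T) (auto intro: step_add relpowp_Suc_I)

lemma configuration_add [simp]: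
  "configuration \<Sigma> k (S + T) \<longleftrightarrow> configuration \<Sigma> k S \<and> configuration \<Sigma> k T"
  unfolding configuration_def by auto

text \<open>The terms of \<open>R\<close> are evaluated one after another, each with the remaining
  terms as untouched context, so the lengths of the evaluations add up.\<close>

lemma relpowp_step_mset:
  assumes "\<And>s. s \<in># R \<Longrightarrow>
    \<exists>m S. configuration \<Sigma> k S \<and> (step \<alpha> ^^ m) {#s#} S \<and> c \<le> real m"
  shows "\<exists>m S. configuration \<Sigma> k S \<and> (step \<alpha> ^^ m) R S \<and> real (size R) * c \<le> real m"
  using assms
proof (induction R)
  case empty
  show ?case
    by (intro exI[of _ 0] exI[of _ "{#}"]) (simp add: configuration_def)
next
  case (add s R)
  obtain m S where R: "configuration \<Sigma> k S" "(step \<alpha> ^^ m) R S" "real (size R) * c \<le> real m"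
    using add by force
  obtain n T where s: "configuration \<Sigma> k T" "(step \<alpha> ^^ n) {#s#} T" "c \<le> real n"
    using add.prems[of s] by auto
  have "(step \<alpha> ^^ (m + n)) (R + {#s#}) (S + T)"
    using relpowp_step_add[OF R(2), of "{#s#}"] relpowp_step_add[OF s(2), of S]
    by (metis relpowp_trans add.commute)
  moreover have "real (size (add_mset s R)) * c \<le> real (m + n)"
    using R s by (simp add: algebra_simps)
  ultimately show ?case
    using R s by (metis add_mset_add_single configuration_add)
qed

lemma rel_mset_exists:
  assumes "\<And>x. x \<in># M \<Longrightarrow> \<exists>y. P x y"
  shows "\<exists>N. rel_mset P M N"
proof -
  obtain g where "\<And>x. x \<in># M \<Longrightarrow> P x (g x)"
    using assms by metis
  then have "rel_mset P M (image_mset g M)"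
    by (induction M) (auto intro: rel_mset_Plus rel_mset_Zero)
  then show ?thesis ..
qed

lemma rel_mset_memD:
  assumes "rel_mset P M N" and "y \<in># N"
  shows "\<exists>x. x \<in># M \<and> P x y"
  using assms by (metis multi_member_split msed_rel_invR union_single_eq_member)

lemma vars_rule_subset_iff:
  "vars_rule \<alpha> \<subseteq> A \<longleftrightarrow> vars_term (lhs \<alpha>) \<subseteq> A \<and> vars_exp (cost \<alpha>) \<subseteq> A \<and>
     (\<forall>t \<in># rhs \<alpha>. vars_term t \<subseteq> A) \<and> vars_form (Conj (guard \<alpha>)) \<subseteq> A"
  unfolding vars_rule_def by blast

text \<open>A comparison with an undefined side is false, so validity of the implication also forces
  \<open>b\<close> to have a value.\<close>

lemma metering_function_nonpos:
  assumes "metering_function xs b \<alpha>" and "vars_rule \<alpha> \<subseteq> dom \<sigma>" and "vars_exp b \<subseteq> dom \<sigma>"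
    and "\<not> models \<sigma> (Conj (guard \<alpha>))"
  shows "\<exists>v. eval \<sigma> b = Some v \<and> v \<le> 0"
  using assms
  by (auto simp: metering_function_def valid_def models_def vars_rule_subset_iff cmp_def)

lemma metering_function_decrease:
  assumes "metering_function xs b \<alpha>" and "vars_rule \<alpha> \<subseteq> dom \<sigma>" and "vars_exp b \<subseteq> dom \<sigma>"
    and "models \<sigma> (Conj (guard \<alpha>))" and t: "t \<in># rhs \<alpha>"
  shows "\<exists>v w. eval \<sigma> b = Some v \<and> eval \<sigma> (subst_exp (map_of (zip xs (args t))) b) = Some w
           \<and> v - 1 \<le> w"
proof -
  let ?b = "subst_exp (map_of (zip xs (args t))) b"
  have "vars_term t \<subseteq> dom \<sigma>"
    using assms(2) t by (simp add: vars_rule_subset_iff)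
  moreover have "(\<Union>u \<in> ran (map_of (zip xs (args t))). vars_exp u) \<subseteq> vars_term t"
    by (cases t) (auto simp: ran_def dest!: map_of_SomeD set_zip_rightD)
  \<comment> \<open>Validity only speaks of substitutions that cover the formula; the variables of
    \<open>?b\<close> come from \<open>b\<close> and from \<open>t\<close>, hence from the
    rule.\<close>
  ultimately have "vars_exp ?b \<subseteq> dom \<sigma>"
    using assms(3) by (intro order_trans[OF vars_subst_exp_subset] Un_least) (simp, rule order_trans)
  moreover have "valid (Imp (Conj (guard \<alpha>)) (Conj [Geq ?b (Minus b (Num 1))]))"
    using assms(1) t by (simp add: metering_function_def)
  ultimately have "cmp (\<ge>) (eval \<sigma> ?b) (eval \<sigma> (Minus b (Num 1)))"
    using assms(2-4) by (auto simp: valid_def models_def vars_rule_subset_iff)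
  then show ?thesis
    by (auto simp: cmp_def lift2_def bind_eq_Some_conv)
qed

lemma geometric_powr_step:
  assumes "d > (1::real)"
  shows "1 + d * ((d powr (v - 1) - 1) / (d - 1)) = (d powr v - 1) / (d - 1)"
proof -
  have "d * d powr (v - 1) = d powr v"
    using assms by (simp add: powr_diff)
  then show ?thesis
    using assms by (simp add: field_simps)
qed

lemma metered_evaluation:
  assumes "distinct xs" and rule: "is_rule \<Sigma> xs \<alpha>" and "well_formed \<alpha>" and simple: "simple_recursion \<alpha>"
    and meter: "metering_function xs b \<alpha>"
    and "vars_rule \<alpha> \<subseteq> dom \<sigma>" and "vars_exp b \<subseteq> dom \<sigma>" and "instance_eq \<sigma> (lhs \<alpha>) s"
    and "eval \<sigma> b = Some v" and "u \<le> v" and "u \<le> real n"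
  shows "\<exists>m S. configuration \<Sigma> (length xs) S \<and> (step \<alpha> ^^ m) {#s#} S \<and>
           (real (degree \<alpha>) powr u - 1) / (real (degree \<alpha>) - 1) \<le> real m"
  using assms(6-)
proof (induction n arbitrary: \<sigma> s u v)
  let ?d = "real (degree \<alpha>)"
  let ?p = "\<lambda>u. (?d powr u - 1) / (?d - 1)"
  have d: "?d > 1"
    using simple by (simp add: simple_recursion_def)
  obtain f where f: "f \<in> \<Sigma>" "lhs \<alpha> = Fn f (map Var xs)"
    using rule by (auto simp: is_rule_def)
  \<comment> \<open>For \<open>u \<le> 0\<close> the bound is at most \<open>0\<close>, so the empty
    evaluation suffices. As \<open>n\<close> bounds \<open>u\<close> only from above, this case also
    occurs in the induction step.\<close>
  have nonpos: "\<exists>m S. configuration \<Sigma> (length xs) S \<and> (step \<alpha> ^^ m) {#s#} S \<and> ?p u \<le> real m"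
    if "u \<le> 0" "instance_eq \<sigma> (lhs \<alpha>) s" for u \<sigma> s
  proof -
    have "?d powr u \<le> ?d powr 0"
      using d \<open>u \<le> 0\<close> by (intro powr_mono) auto
    then have "?p u \<le> real 0"
      using d by (simp add: divide_nonpos_pos)
    moreover have "configuration \<Sigma> (length xs) {#s#}"
      using that f by (auto simp: configuration_def instance_eq_def dest: list_all2_lengthD)
    moreover have "(step \<alpha> ^^ 0) {#s#} {#s#}" by simp
    ultimately show ?thesis by blast
  qed
  {
    case 0
    then show ?case using nonpos by simp
  next
    case (Suc n)
    show ?case
    proof (cases "u \<le> 0")
      case True
      then show ?thesis using nonpos[of u \<sigma> s] Suc.prems by simp
    next
      case False
      \<comment> \<open>If the guard failed, the value \<open>v\<close> of \<open>b\<close> would be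
        at most \<open>0\<close>, against \<open>0 < u \<le> v\<close>.\<close>
      then have guard: "models \<sigma> (Conj (guard \<alpha>))"
        using metering_function_nonpos[OF meter, of \<sigma>] Suc.prems by fastforce
      have "\<exists>s. instance_eq \<sigma> t s" if "t \<in># rhs \<alpha>" for t
      proof -
        have "\<forall>e \<in> set (args t). \<exists>n. eval \<sigma> e = Some (real_of_int n)"
          using \<open>well_formed \<alpha>\<close> guard Suc.prems that unfolding well_formed_def by blast
        then obtain g where "\<forall>e \<in> set (args t). eval \<sigma> e = Some (real_of_int (g e))"
          by metis
        then have "instance_eq \<sigma> t (root t, map g (args t))"
          by (simp add: instance_eq_def list_all2_map2 list_all2_same)
        then show ?thesis ..
      qed
      then obtain R where R: "rel_mset (instance_eq \<sigma>) (rhs \<alpha>) R"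
        using rel_mset_exists by metis
      have step: "step \<alpha> {#s#} R"
        using guard Suc.prems R unfolding step_def
        by (intro exI[of _ s] exI[of _ \<sigma>] exI[of _ R]) simp
      have "\<exists>m S. configuration \<Sigma> (length xs) S \<and> (step \<alpha> ^^ m) {#r#} S \<and> ?p (u - 1) \<le> real m"
        if r: "r \<in># R" for r
      proof -
        obtain t where t: "t \<in># rhs \<alpha>" "instance_eq \<sigma> t r"
          using rel_mset_memD[OF R r] by blast
        let ?\<tau> = "\<sigma> ++ map_of (zip xs (snd r))"
        have args: "list_all2 (\<lambda>e n. eval \<sigma> e = Some (real_of_int n)) (args t) (snd r)"
          "length (args t) = length xs"
          using t rule by (auto simp: instance_eq_def is_rule_def)
        then have len: "length xs = length (snd r)"
          by (auto dest: list_all2_lengthD)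
        obtain w where w: "eval ?\<tau> b = Some w" "v - 1 \<le> w"
          using metering_function_decrease[OF meter Suc.prems(1,2) guard t(1)] Suc.prems(4)
          by (auto simp: eval_subst_exp_zip[OF args])
        have dom: "dom \<sigma> \<subseteq> dom ?\<tau>" by auto
        have inst: "instance_eq ?\<tau> (lhs \<alpha>) r"
          using eval_map_Var_zip[OF \<open>distinct xs\<close> len] t simple f
          by (auto simp: instance_eq_def simple_recursion_def)
        show ?thesis
          \<comment> \<open>The induction hypothesis is used for \<open>u - 1\<close>: it lies below
            \<open>w\<close> since \<open>u - 1 \<le> v - 1 \<le> w\<close>, and
            \<open>u \<le> n + 1\<close> gives \<open>u - 1 \<le> n\<close>.\<close>
          using Suc.prems w dom by (intro Suc.IH[OF _ _ inst, of w]) auto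
      qed
      then obtain m S where S: "configuration \<Sigma> (length xs) S" "(step \<alpha> ^^ m) R S"
        "real (size R) * ?p (u - 1) \<le> real m"
        using relpowp_step_mset[of R \<Sigma> "length xs" \<alpha> "?p (u - 1)"] by blast
      \<comment> \<open>The \<open>1\<close> counts the step from \<open>s\<close> to
        \<open>R\<close>, and the factor \<open>?d\<close> counts the terms of
        \<open>R\<close>.\<close>
      have "?p u = 1 + ?d * ?p (u - 1)"
        using geometric_powr_step[OF d] by simp
      also have "size R = degree \<alpha>"
        using R by (simp add: degree_def rel_mset_size)
      then have "1 + ?d * ?p (u - 1) \<le> real (Suc m)"
        using S by simp
      finally have "?p u \<le> real (Suc m)" .
      moreover have "(step \<alpha> ^^ Suc m) {#s#} S"
        using step S relpowp_Suc_I2 by metis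
      ultimately show ?thesis using S by blast
    qed
  }
qed

theorem theorem4p3:
  fixes \<Sigma> :: "'f set" and xs :: "'v list" and k d :: nat
    and \<alpha> :: "('f, 'v) prule" and b :: "'v aexp" and \<sigma> :: "'v isubst"
  assumes "finite \<Sigma>" and "distinct xs" and "length xs = k"
    and "is_rule \<Sigma> xs \<alpha>"
    and "well_formed \<alpha>" and "simple_recursion \<alpha>" and "degree \<alpha> = d"
    and "metering_function xs b \<alpha>"
    and "vars_rule \<alpha> \<subseteq> dom \<sigma>" and "vars_exp b \<subseteq> dom \<sigma>"
  shows "\<exists>s v m S. instance_eq \<sigma> (lhs \<alpha>) s \<and> eval \<sigma> b = Some v \<and>
           configuration \<Sigma> k S \<and> (step \<alpha> ^^ m) {#s#} S \<and>
           real m \<ge> (real d powr v - 1) / (real d - 1)"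
proof -
  obtain f where f: "lhs \<alpha> = Fn f (map Var xs)"
    using \<open>is_rule \<Sigma> xs \<alpha>\<close> by (auto simp: is_rule_def)
  have "set xs \<subseteq> dom \<sigma>"
    using \<open>vars_rule \<alpha> \<subseteq> dom \<sigma>\<close> f by (auto simp: vars_rule_subset_iff)
  then have inst: "instance_eq \<sigma> (lhs \<alpha>) (f, map (the \<circ> \<sigma>) xs)"
    by (auto simp: f instance_eq_def list_all2_conv_all_nth subset_iff dom_def)
  \<comment> \<open>If the guard holds, it is the decrease condition of some recursive call that
    shows \<open>b\<close> to be defined, so a call must exist.\<close>
  have "rhs \<alpha> \<noteq> {#}"
    using \<open>simple_recursion \<alpha>\<close> by (auto simp: simple_recursion_def degree_def)
  then obtain t where "t \<in># rhs \<alpha>"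
    using multiset_nonemptyE by blast
  then obtain v where v: "eval \<sigma> b = Some v"
    using assms metering_function_nonpos[of xs b \<alpha> \<sigma>] metering_function_decrease[of xs b \<alpha> \<sigma>]
    by blast
  \<comment> \<open>This provides the induction bound, also for negative \<open>v\<close>, where
    \<open>nat\<close> gives \<open>0\<close>; the parameter \<open>u\<close> is taken to be
    \<open>v\<close> itself.\<close>
  have "v \<le> real (nat \<lceil>v\<rceil>)"
    by linarith
  from metered_evaluation[OF assms(2,4,5,6,8,9,10) inst v order_refl this] show ?thesis
    using inst v assms(3,7) by blast
qed

end
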